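(* Let $G$ be a simple digraph. If every irreducible undirected path of length $3$ in $G$ has a directed centre, and every directed cycle of length $2$ or $3$ in $G$ has a cycle centre, then $\vec\beta_1(G)=0$ and $\vec\beta_1^{\mathrm{reg}}(G)=0$.
   Context: A simple digraph is $G=(V,E)$ with $E\subseteq\{(i,j)\in V\times V: i\neq j\}$ (both $(i,j)$ and $(j,i)$ may be present). For a subgraph $\sigma\subseteq G$ and a set $E_2$ of edges of $G$, $\sigma\cup E_2$ is the digraph with edge set $E(\sigma)\cup E_2$ and vertex set $V(\sigma)$ together with all endpoints of edges in $E_2$; for a single edge $e$ write $\sigma\cup e$. An undirected path of length $3$ in $G$ on vertices $(v_0,v_1,v_2,v_3)$ is a subgraph $\sigma$ consisting of four distinct vertices $v_0,\dots,v_3$ and three edges $\tau_1,\tau_2,\tau_3\in E$ with $\tau_i=(v_{i-1},v_i)$ or $\tau_i=(v_i,v_{i-1})$. It is reducible if there is an edge $e=(v_i,v_j)\in E(G)$ with $|i-j|>1$ such that $\vec\beta_1(\sigma\cup e)=0$; otherwise it is irreducible. For $\kappa\in V(G)\setminus V(\sigma)$ let $J_{\sigma,\kappa}$ be the set of all edges of $G$ of the form $(v_i,\kappa)$ or $(\kappa,v_i)$. The vertex $\kappa$ is a directed centre for $\sigma$ if there is a subset $J'\subseteq J_{\sigma,\kappa}$ such that $\vec\beta_1(\sigma\cup J')=0$ and $\sigma\cup J'$ contains an undirected path of length $2$ on the vertices $(v_0,\kappa,v_3)$ (i.e. an edge, in some direction, between $v_0$ and $\kappa$ and an edge, in some direction,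 between $\kappa$ and $v_3$). A directed cycle of length $k$ is given by distinct vertices $v_0,\dots,v_{k-1}$ with $(v_i,v_{i+1})\in E$ for all $i$ (indices mod $k$). A cycle centre for it is a vertex $\kappa\in V(G)\setminus\{v_0,\dots,v_{k-1}\}$ such that $(\kappa,v_i)\in E(G)$ for all $i$, or $(v_i,\kappa)\in E(G)$ for all $i$. Path homology (coefficients in $\mathbb{Z}$). For $m\ge 0$ let $\Lambda_m$ be the free $\mathbb{Z}$-module with basis $e_{v_0\dots v_m}$ over all sequences of $m+1$ vertices, and let $\mathcal{A}_m\subseteq\Lambda_m$ be the submodule spanned by the allowed sequences, i.e. those with $(v_i,v_{i+1})\in E$ for all $i$. Put $\Lambda_{-1}=\mathcal{A}_{-1}=\mathbb{Z}$. For $m\geq 1$ let $\partial_m:\Lambda_m\to\Lambda_{m-1}$, $\partial_m(e_{v_0\dots v_m})=\sum_{i=0}^m(-1)^i e_{v_0\dots\hat{v_i}\dots v_m}$, and let $\partial_0:\Lambda_0\to\mathbb{Z}$ be the sum of coefficients. Let $\Omega_m=\{v\in\mathcal{A}_m:\partial_m v\in\mathcal{A}_{m-1}\}$ for $m\ge0$ and $\Omega_{-1}=\mathbb{Z}$. The non-regular chain complex is $\cdots\to\Omega_2\to\Omega_1\to\Omega_0\to\mathbb{Z}\to0$ with the restrictions of $\partial_m$; $\vec\beta_k(G)=\operatorname{rank}(\ker\partial_k/\operatorname{im}\partial_{k+1})$. For the regular version, let $\pi$ be the projection sending every basis sequence having two equal consecutive vertices to $0$ and fixing the others, let $\partial^{\mathrm{reg}}_m=\pi\circ\partial_m$,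 $\Omega^{\mathrm{reg}}_m=\{v\in\mathcal{A}_m:\partial^{\mathrm{reg}}_m v\in\mathcal{A}_{m-1}\}$ (again augmented by $\mathbb{Z}$ in degree $-1$); $\vec\beta^{\mathrm{reg}}_k(G)$ is the rank of the $k$-th homology group of this complex. *)

theory Defs
  imports
    "Graph_Theory.Pair_Digraph"
    "HOL-Algebra.Free_Abelian_Groups"
    "HOL-Library.Extended_Nat"
begin

text \<open>
  Simple digraphs are the loop-free pair digraphs of \<open>Graph_Theory\<close>
  (locale \<open>pair_loopfree_digraph\<close>), which need not be finite.
\<close>

section \<open>Rank of an abelian group\<close>

definition int_independent :: "('a, 'b) monoid_scheme \<Rightarrow> 'a set \<Rightarrow> bool" where
  "int_independent A S \<longleftrightarrow> finite S \<and> S \<subseteq> carrier A \<and>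
     (\<forall>c :: 'a \<Rightarrow> int. finprod A (\<lambda>x. x [^]\<^bsub>A\<^esub> c x) S = \<one>\<^bsub>A\<^esub> \<longrightarrow> (\<forall>x\<in>S. c x = 0))"

definition abelian_rank :: "('a, 'b) monoid_scheme \<Rightarrow> enat" where
  "abelian_rank A = (SUP S \<in> {S. int_independent A S}. enat (card S))"

section \<open>Path homology\<close>

text \<open>
  The basis element indexed by the vertices \<open>v\<^sub>0, \<dots>, v\<^sub>m\<close> is \<open>frag_of [v\<^sub>0, \<dots>, v\<^sub>m]\<close>.
  Degree \<open>-1\<close> of the augmented complex is the free group on the empty list, that is,
  the integers; \<open>path_boundary\<close> in degree \<open>0\<close> is then the sum of the coefficients.
\<close>

definition vertex_seqs :: "'a pair_pre_digraph \<Rightarrow> int \<Rightarrow> 'a list set" where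
  "vertex_seqs G m = {vs. int (length vs) = m + 1 \<and> set vs \<subseteq> pverts G}"

definition allowed_seqs :: "'a pair_pre_digraph \<Rightarrow> int \<Rightarrow> 'a list set" where
  "allowed_seqs G m = {vs \<in> vertex_seqs G m. successively (\<lambda>u v. (u, v) \<in> parcs G) vs}"

abbreviation all_chains :: "'a pair_pre_digraph \<Rightarrow> int \<Rightarrow> ('a list \<Rightarrow>\<^sub>0 int) monoid" where
  "all_chains G m \<equiv> free_Abelian_group (vertex_seqs G m)"

abbreviation allowed_chains :: "'a pair_pre_digraph \<Rightarrow> int \<Rightarrow> ('a list \<Rightarrow>\<^sub>0 int) monoid" where
  "allowed_chains G m \<equiv> free_Abelian_group (allowed_seqs G m)"

definition path_boundary :: "('a list \<Rightarrow>\<^sub>0 int) \<Rightarrow> ('a list \<Rightarrow>\<^sub>0 int)" where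
  "path_boundary =
     frag_extend (\<lambda>vs. \<Sum>i<length vs. frag_cmul ((-1) ^ i) (frag_of (take i vs @ drop (Suc i) vs)))"

definition regular_proj :: "('a list \<Rightarrow>\<^sub>0 int) \<Rightarrow> ('a list \<Rightarrow>\<^sub>0 int)" where
  "regular_proj = frag_extend (\<lambda>vs. if distinct_adj vs then frag_of vs else 0)"

definition regular_path_boundary :: "('a list \<Rightarrow>\<^sub>0 int) \<Rightarrow> ('a list \<Rightarrow>\<^sub>0 int)" where
  "regular_path_boundary = regular_proj \<circ> path_boundary"

text \<open>
  The following notions take the boundary map \<open>d\<close> as a parameter, to be instantiated
  with \<open>path_boundary\<close> or \<open>regular_path_boundary\<close>.
\<close>

definition invariant_chains ::
  "(('a list \<Rightarrow>\<^sub>0 int) \<Rightarrow> ('a list \<Rightarrow>\<^sub>0 int)) \<Rightarrow> 'a pair_pre_digraph \<Rightarrow> int \<Rightarrow> ('a list \<Rightarrow>\<^sub>0 int) set" where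
  "invariant_chains d G m =
     {c \<in> carrier (allowed_chains G m). d c \<in> carrier (allowed_chains G (m - 1))}"

definition path_cycles ::
  "(('a list \<Rightarrow>\<^sub>0 int) \<Rightarrow> ('a list \<Rightarrow>\<^sub>0 int)) \<Rightarrow> 'a pair_pre_digraph \<Rightarrow> int \<Rightarrow> ('a list \<Rightarrow>\<^sub>0 int) set" where
  "path_cycles d G k = {c \<in> invariant_chains d G k. d c = 0}"

definition path_boundaries ::
  "(('a list \<Rightarrow>\<^sub>0 int) \<Rightarrow> ('a list \<Rightarrow>\<^sub>0 int)) \<Rightarrow> 'a pair_pre_digraph \<Rightarrow> int \<Rightarrow> ('a list \<Rightarrow>\<^sub>0 int) set" where
  "path_boundaries d G k = d ` invariant_chains d G (k + 1)"

definition path_homology ::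
  "(('a list \<Rightarrow>\<^sub>0 int) \<Rightarrow> ('a list \<Rightarrow>\<^sub>0 int)) \<Rightarrow> 'a pair_pre_digraph \<Rightarrow> int \<Rightarrow> ('a list \<Rightarrow>\<^sub>0 int) set monoid" where
  "path_homology d G k =
     subgroup_generated (all_chains G k) (path_cycles d G k) Mod path_boundaries d G k"

definition path_betti :: "int \<Rightarrow> 'a pair_pre_digraph \<Rightarrow> enat" where
  "path_betti k G = abelian_rank (path_homology path_boundary G k)"

definition regular_path_betti :: "int \<Rightarrow> 'a pair_pre_digraph \<Rightarrow> enat" where
  "regular_path_betti k G = abelian_rank (path_homology regular_path_boundary G k)"

section \<open>Undirected paths, directed cycles and their centres\<close>

definition union_arcs :: "'a pair_pre_digraph \<Rightarrow> 'a rel \<Rightarrow> 'a pair_pre_digraph" where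
  "union_arcs \<sigma> F = \<lparr>pverts = pverts \<sigma> \<union> fst ` F \<union> snd ` F, parcs = parcs \<sigma> \<union> F\<rparr>"

text \<open>
  The length of the path is \<open>length vs - 1\<close>. Exactly one arc of \<open>G\<close> is chosen between each
  two consecutive vertices, even if \<open>G\<close> has arcs in both directions.
\<close>

definition undirected_path ::
  "'a pair_pre_digraph \<Rightarrow> 'a list \<Rightarrow> 'a pair_pre_digraph \<Rightarrow> bool" where
  "undirected_path G vs \<sigma> \<longleftrightarrow>
     vs \<noteq> [] \<and> distinct vs \<and> set vs \<subseteq> pverts G \<and> pverts \<sigma> = set vs \<and>
     (\<exists>\<tau>. (\<forall>i < length vs - 1. \<tau> i \<in> parcs G \<and>
             (\<tau> i = (vs ! i, vs ! Suc i) \<or> \<tau> i = (vs ! Suc i, vs ! i))) \<and>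
          parcs \<sigma> = \<tau> ` {..<length vs - 1})"

definition reducible ::
  "'a pair_pre_digraph \<Rightarrow> 'a list \<Rightarrow> 'a pair_pre_digraph \<Rightarrow> bool" where
  "reducible G vs \<sigma> \<longleftrightarrow>
     (\<exists>i < length vs. \<exists>j < length vs. \<bar>int i - int j\<bar> > 1 \<and> (vs ! i, vs ! j) \<in> parcs G \<and>
        path_betti 1 (union_arcs \<sigma> {(vs ! i, vs ! j)}) = 0)"

definition joining_arcs ::
  "'a pair_pre_digraph \<Rightarrow> 'a pair_pre_digraph \<Rightarrow> 'a \<Rightarrow> 'a rel" where
  "joining_arcs G \<sigma> \<kappa> = {e \<in> parcs G. \<exists>v \<in> pverts \<sigma>. e = (v, \<kappa>) \<or> e = (\<kappa>, v)}"

definition directed_centre ::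
  "'a pair_pre_digraph \<Rightarrow> 'a list \<Rightarrow> 'a pair_pre_digraph \<Rightarrow> 'a \<Rightarrow> bool" where
  "directed_centre G vs \<sigma> \<kappa> \<longleftrightarrow>
     \<kappa> \<in> pverts G - pverts \<sigma> \<and>
     (\<exists>J \<subseteq> joining_arcs G \<sigma> \<kappa>.
        path_betti 1 (union_arcs \<sigma> J) = 0 \<and>
        (\<exists>\<rho>. undirected_path (union_arcs \<sigma> J) [hd vs, \<kappa>, last vs] \<rho>))"

definition directed_cycle :: "'a pair_pre_digraph \<Rightarrow> 'a list \<Rightarrow> bool" where
  "directed_cycle G vs \<longleftrightarrow>
     vs \<noteq> [] \<and> distinct vs \<and> set vs \<subseteq> pverts G \<and>
     (\<forall>i < length vs. (vs ! i, vs ! (Suc i mod length vs)) \<in> parcs G)"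

definition cycle_centre :: "'a pair_pre_digraph \<Rightarrow> 'a list \<Rightarrow> 'a \<Rightarrow> bool" where
  "cycle_centre G vs \<kappa> \<longleftrightarrow>
     \<kappa> \<in> pverts G - set vs \<and>
     ((\<forall>v \<in> set vs. (\<kappa>, v) \<in> parcs G) \<or> (\<forall>v \<in> set vs. (v, \<kappa>) \<in> parcs G))"

end

theory Submission
  imports Defs
begin

text \<open>
  Call a 1-chain a torsion boundary if some nonzero multiple of it bounds.  The cycle group is
  generated by the chains of closed undirected walks, and these are torsion boundaries by
  induction on the length: a walk with a repeated vertex splits into two shorter closed walks;
  in a closed walk of length at least 4 without repetition, three consecutive steps form an
  undirected path of length 3, which an extra arc (reducible case) or a directed centre replaces
  by a path of length at most 2, homologous up to torsion; closed walks of length 2 or 3 are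
  degenerate, transitive triangles, or directed cycles, and the latter are cones over a cycle
  centre.  The regular complex has the same 1-cycles and at least as many boundaries.
\<close>

section \<open>Abelian groups of rank zero\<close>

text \<open>An element of infinite order forms an independent singleton. Conversely, a torsion
  element of an independent set would give a nontrivial relation supported at that element, so in a
  torsion group only the empty set is independent.\<close>

lemma (in comm_group) abelian_rank_eq_0_iff:
  "abelian_rank G = 0 \<longleftrightarrow> (\<forall>x\<in>carrier G. \<exists>n::int. n \<noteq> 0 \<and> x [^] n = \<one>)"
proof -
  have "abelian_rank G = 0 \<longleftrightarrow> (\<forall>S. int_independent G S \<longrightarrow> S = {})"
    unfolding abelian_rank_def bot_enat_def [symmetric] SUP_bot_conv
    by (auto simp: bot_enat_def enat_0_iff int_independent_def)
  also have "\<dots> \<longleftrightarrow> (\<forall>x\<in>carrier G. \<exists>n::int. n \<noteq> 0 \<and> x [^] n = \<one>)"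
  proof safe
    fix x assume all: "\<forall>S. int_independent G S \<longrightarrow> S = {}" and x: "x \<in> carrier G"
    from all have "\<not> int_independent G {x}"
      by blast
    with x obtain c :: "'a \<Rightarrow> int" where "finprod G (\<lambda>x. x [^] c x) {x} = \<one>" "c x \<noteq> 0"
      by (auto simp: int_independent_def)
    with x show "\<exists>n::int. n \<noteq> 0 \<and> x [^] n = \<one>"
      by (intro exI [of _ "c x"]) simp
  next
    fix S x
    assume torsion: "\<forall>x\<in>carrier G. \<exists>n::int. n \<noteq> 0 \<and> x [^] n = \<one>"
      and S: "int_independent G S" and x: "x \<in> S"
    from S have fin: "finite S" and sub: "S \<subseteq> carrier G"
      by (auto simp: int_independent_def)
    from torsion x sub obtain n :: int where n: "n \<noteq> 0" "x [^] n = \<one>"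
      by blast
    define c :: "'a \<Rightarrow> int" where "c y = (if y = x then n else 0)" for y
    have "finprod G (\<lambda>y. y [^] c y) S = \<one>"
      by (rule finprod_one_eqI) (use n in \<open>auto simp: c_def\<close>)
    with S x have "c x = 0"
      by (simp add: int_independent_def)
    with n show "x \<in> {}"
      by (simp add: c_def)
  qed
  finally show ?thesis .
qed

text \<open>Turns the rank of a homology group into a statement about cycles: a power of the coset
  of \<open>z\<close> is trivial exactly when that power of \<open>z\<close> lies in
  \<open>B\<close>.\<close>

lemma (in comm_group) abelian_rank_quotient_eq_0_iff:
  assumes Z: "subgroup Z G" and B: "subgroup B G" and sub: "B \<subseteq> Z"
  shows "abelian_rank (subgroup_generated G Z Mod B) = 0 \<longleftrightarrow>
    (\<forall>z\<in>Z. \<exists>n::int. n \<noteq> 0 \<and> z [^] n \<in> B)"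
proof -
  let ?Z = "subgroup_generated G Z"
  have carr: "carrier ?Z = Z"
    by (rule subgroup.carrier_subgroup_generated_subgroup [OF Z])
  interpret Z: comm_group ?Z
    by (rule abelian_subgroup_generated [OF comm_group_axioms])
  have BZ: "subgroup B ?Z"
    using B sub carr subgroup_subgroup_generated_iff by blast
  interpret N: normal B ?Z
    by (rule Z.subgroup_imp_normal [OF BZ])
  interpret Q: comm_group "?Z Mod B"
    by (rule Z.abelian_FactGroup [OF BZ])
  have "(r_coset ?Z B z) [^]\<^bsub>?Z Mod B\<^esub> n = \<one>\<^bsub>?Z Mod B\<^esub> \<longleftrightarrow> z [^] n \<in> B"
    if "z \<in> Z" for z and n :: int
  proof -
    have "(r_coset ?Z B z) [^]\<^bsub>?Z Mod B\<^esub> n = r_coset ?Z B (z [^]\<^bsub>?Z\<^esub> n)"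
      using that carr N.FactGroup_int_pow by simp
    moreover have "r_coset ?Z B (z [^]\<^bsub>?Z\<^esub> n) = B \<longleftrightarrow> z [^]\<^bsub>?Z\<^esub> n \<in> B"
      using that carr BZ Z.coset_join1 Z.coset_join2 Z.int_pow_closed N.subset by metis
    moreover have "z [^]\<^bsub>?Z\<^esub> n = z [^] n"
      using that carr int_pow_subgroup_generated by simp
    ultimately show ?thesis
      by simp
  qed
  then show ?thesis
    unfolding Q.abelian_rank_eq_0_iff carrier_FactGroup carr by simp
qed

section \<open>Path homology modulo torsion\<close>

text \<open>The boundary map is the same for all graphs; only the allowed sequences grow with the
  graph. This is how boundaries found in a small subgraph become boundaries in the whole
  graph.\<close>

lemma invariant_chains_mono:
  assumes "pverts H \<subseteq> pverts G" "parcs H \<subseteq> parcs G"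
  shows "invariant_chains d H m \<subseteq> invariant_chains d G m"
proof -
  have "allowed_seqs H k \<subseteq> allowed_seqs G k" for k
    using assms by (auto simp: allowed_seqs_def vertex_seqs_def elim: successively_mono)
  then show ?thesis
    by (fastforce simp: invariant_chains_def)
qed

lemma path_boundaries_mono:
  assumes "pverts H \<subseteq> pverts G" "parcs H \<subseteq> parcs G"
  shows "path_boundaries d H m \<subseteq> path_boundaries d G m"
  using invariant_chains_mono [OF assms] by (auto simp: path_boundaries_def)

lemma subgroup_free_Abelian_groupI:
  assumes "0 \<in> B" "\<And>b. b \<in> B \<Longrightarrow> Poly_Mapping.keys b \<subseteq> S" "\<And>a b. a \<in> B \<Longrightarrow> b \<in> B \<Longrightarrow> a - b \<in> B"
  shows "subgroup B (free_Abelian_group S)"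
proof -
  have minus: "- b \<in> B" if "b \<in> B" for b
    using assms(1) assms(3) [of 0 b] that by simp
  have "a + b \<in> B" if "a \<in> B" "b \<in> B" for a b
    using assms(3) [of a "- b"] minus that by simp
  with minus show ?thesis
    using assms by (intro group.subgroupI) auto
qed

text \<open>The map \<open>d\<close> is kept abstract so that one argument serves both complexes.
  Additivity makes cycles and boundaries subgroups, and \<open>dd\<close> puts the boundaries inside
  the cycles.\<close>

lemma path_homology_rank_eq_0_iff:
  assumes diff: "\<And>a b. d (a - b) = d a - d b"
    and dd: "\<And>c. c \<in> invariant_chains d G (k + 1) \<Longrightarrow> d (d c) = 0"
  shows "abelian_rank (path_homology d G k) = 0 \<longleftrightarrow>
    (\<forall>z\<in>path_cycles d G k. \<exists>n. n \<noteq> 0 \<and> frag_cmul n z \<in> path_boundaries d G k)"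
proof -
  have d0: "d 0 = 0"
    using diff [of 0 0] by simp
  have inv_diff: "a - b \<in> invariant_chains d G m"
    if "a \<in> invariant_chains d G m" "b \<in> invariant_chains d G m" for a b m
    using that order_trans [OF keys_diff [of a b]] order_trans [OF keys_diff [of "d a" "d b"]]
    by (auto simp: invariant_chains_def diff)
  have inv_0: "0 \<in> invariant_chains d G m" for m
    by (simp add: invariant_chains_def d0)
  have allowed: "allowed_seqs G m \<subseteq> vertex_seqs G m" for m
    by (auto simp: allowed_seqs_def)
  have sub: "path_boundaries d G k \<subseteq> path_cycles d G k"
    using dd d0 by (auto simp: path_boundaries_def path_cycles_def invariant_chains_def)
  have cycles: "subgroup (path_cycles d G k) (all_chains G k)"
  proof (rule subgroup_free_Abelian_groupI)
    fix b assume "b \<in> path_cycles d G k"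
    with allowed show "Poly_Mapping.keys b \<subseteq> vertex_seqs G k"
      by (fastforce simp: path_cycles_def invariant_chains_def)
  qed (auto simp: path_cycles_def inv_diff inv_0 d0 diff)
  have bounds: "subgroup (path_boundaries d G k) (all_chains G k)"
  proof (rule subgroup_free_Abelian_groupI)
    show "0 \<in> path_boundaries d G k"
      unfolding path_boundaries_def using inv_0 d0 by (metis imageI)
    fix b assume b: "b \<in> path_boundaries d G k"
    with sub allowed show "Poly_Mapping.keys b \<subseteq> vertex_seqs G k"
      by (fastforce simp: path_cycles_def invariant_chains_def)
    fix a assume "a \<in> path_boundaries d G k"
    with b obtain a' b' where "a' \<in> invariant_chains d G (k + 1)" "a = d a'"
      "b' \<in> invariant_chains d G (k + 1)" "b = d b'"
      unfolding path_boundaries_def by blast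
    then show "a - b \<in> path_boundaries d G k"
      unfolding path_boundaries_def by (intro image_eqI [of _ _ "a' - b'"]) (simp_all add: diff inv_diff)
  qed
  have pow: "z [^]\<^bsub>all_chains G k\<^esub> n = frag_cmul n z" if "z \<in> path_cycles d G k" for z and n :: int
    using subgroup.mem_carrier [OF cycles that] by simp
  show ?thesis
    unfolding path_homology_def
      comm_group.abelian_rank_quotient_eq_0_iff [OF abelian_free_Abelian_group cycles bounds sub]
    by (simp add: pow)
qed

lemma path_boundary_diff: "path_boundary (a - b) = path_boundary a - path_boundary b"
  by (simp add: path_boundary_def frag_extend_diff)

lemma regular_path_boundary_diff:
  "regular_path_boundary (a - b) = regular_path_boundary a - regular_path_boundary b"
  by (simp add: regular_path_boundary_def regular_proj_def path_boundary_diff frag_extend_diff)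

lemma path_boundary_of2: "path_boundary (frag_of [u, v]) = frag_of [v] - frag_of [u]"
  by (simp add: path_boundary_def numeral_2_eq_2)

lemma path_boundary_of3:
  "path_boundary (frag_of [u, v, w]) = frag_of [v, w] - frag_of [u, w] + frag_of [u, v]"
  by (simp add: path_boundary_def numeral_3_eq_3)

section \<open>Chains of degree one and two\<close>

lemma allowed_seqs_0: "vs \<in> allowed_seqs G 0 \<longleftrightarrow> (\<exists>u. vs = [u] \<and> u \<in> pverts G)"
  by (auto simp: allowed_seqs_def vertex_seqs_def length_Suc_conv)

lemma allowed_seqs_1:
  "vs \<in> allowed_seqs G 1 \<longleftrightarrow>
    (\<exists>u v. vs = [u, v] \<and> (u, v) \<in> parcs G \<and> u \<in> pverts G \<and> v \<in> pverts G)"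
proof -
  have "int (length vs) = 1 + 1 \<longleftrightarrow> length vs = 2"
    by linarith
  then show ?thesis
    by (auto simp: allowed_seqs_def vertex_seqs_def length_Suc_conv numeral_2_eq_2)
qed

lemma allowed_seqs_2:
  "vs \<in> allowed_seqs G 2 \<longleftrightarrow>
    (\<exists>u v w. vs = [u, v, w] \<and> (u, v) \<in> parcs G \<and> (v, w) \<in> parcs G \<and>
      u \<in> pverts G \<and> v \<in> pverts G \<and> w \<in> pverts G)"
proof -
  have "int (length vs) = 2 + 1 \<longleftrightarrow> length vs = 3"
    by linarith
  then show ?thesis
    by (auto simp: allowed_seqs_def vertex_seqs_def length_Suc_conv numeral_3_eq_3)
qed

lemma path_boundary_0: "path_boundary 0 = 0"
  by (simp add: path_boundary_def)

text \<open>The faces of an arc are its end vertices, so every allowed chain of degree 1 is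
  invariant.\<close>

lemma keys_path_boundary_1:
  assumes "Poly_Mapping.keys c \<subseteq> allowed_seqs G 1"
  shows "Poly_Mapping.keys (path_boundary c) \<subseteq> allowed_seqs G 0"
  using assms
proof (induction c rule: frag_induction)
  case (one vs)
  then show ?case
    by (auto simp: allowed_seqs_0 allowed_seqs_1 path_boundary_of2 dest!: subsetD [OF keys_diff])
next
  case (diff a b)
  then show ?case
    using keys_diff [of "path_boundary a" "path_boundary b"] by (auto simp: path_boundary_diff)
qed (simp add: path_boundary_0)

text \<open>The faces of an arc are one-vertex sequences, which \<open>regular_proj\<close> fixes;
  hence the two complexes have the same 1-cycles.\<close>

lemma regular_path_boundary_1:
  assumes "Poly_Mapping.keys c \<subseteq> allowed_seqs G 1"
  shows "regular_path_boundary c = path_boundary c"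
  using assms
proof (induction c rule: frag_induction)
  case (one vs)
  then show ?case
    by (auto simp: allowed_seqs_1 path_boundary_of2 regular_path_boundary_def regular_proj_def
        frag_extend_diff)
next
  case (diff a b)
  then show ?case
    by (simp add: path_boundary_diff regular_path_boundary_diff)
qed (simp add: path_boundary_0 regular_path_boundary_def regular_proj_def)

lemma path_cycles_1:
  "path_cycles path_boundary G 1 = {c. Poly_Mapping.keys c \<subseteq> allowed_seqs G 1 \<and> path_boundary c = 0}"
  "path_cycles regular_path_boundary G 1 = path_cycles path_boundary G 1"
  using keys_path_boundary_1 [where G = G] regular_path_boundary_1 [where G = G]
  by (auto simp: path_cycles_def invariant_chains_def)

lemma path_boundary_path_boundary:
  assumes "Poly_Mapping.keys c \<subseteq> allowed_seqs G 2"
  shows "path_boundary (path_boundary c) = 0"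
  using assms
proof (induction c rule: frag_induction)
  case (one vs)
  then show ?case
    by (auto simp: allowed_seqs_2 path_boundary_of3 path_boundary_of2 path_boundary_diff
        path_boundary_def frag_extend_add frag_extend_diff numeral_2_eq_2)
qed (simp_all add: path_boundary_0 path_boundary_diff)

lemma regular_path_boundary_regular_path_boundary:
  assumes "Poly_Mapping.keys c \<subseteq> allowed_seqs G 2"
  shows "regular_path_boundary (regular_path_boundary c) = 0"
  using assms
proof (induction c rule: frag_induction)
  case (one vs)
  then obtain u v w where vs: "vs = [u, v, w]"
    by (auto simp: allowed_seqs_2)
  have [simp]: "regular_path_boundary (frag_of [x, y]) = frag_of [y] - frag_of [x]" for x y :: 'a
    by (simp add: regular_path_boundary_def path_boundary_of2 regular_proj_def frag_extend_diff)
  have add: "regular_path_boundary (a + b) = regular_path_boundary a + regular_path_boundary b"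
    for a b :: "'a list \<Rightarrow>\<^sub>0 int"
    using regular_path_boundary_diff [of "a + b" b] by simp
  have zero: "regular_path_boundary 0 = (0 :: 'a list \<Rightarrow>\<^sub>0 int)"
    using regular_path_boundary_diff [of 0 0] by simp
  \<comment> \<open>A dropped face \<open>[x, x]\<close> would have contributed
    \<open>[x] - [x] = 0\<close>, so the second boundary cancels as in the non-regular case.\<close>
  have "regular_path_boundary (frag_of vs) = (if v = w then 0 else frag_of [v, w])
      - (if u = w then 0 else frag_of [u, w]) + (if u = v then 0 else frag_of [u, v])"
    unfolding regular_path_boundary_def vs
    by (simp add: path_boundary_of3 regular_proj_def frag_extend_diff frag_extend_add)
  then show ?case
    by (simp add: add regular_path_boundary_diff zero)
next
  case zero
  show ?case
    by (simp add: regular_path_boundary_def regular_proj_def path_boundary_0)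
qed (simp add: regular_path_boundary_diff)

lemma regular_proj_allowed:
  assumes "pair_loopfree_digraph G" "Poly_Mapping.keys c \<subseteq> allowed_seqs G 1"
  shows "regular_proj c = c"
  using assms(2)
proof (induction c rule: frag_induction)
  case (one vs)
  then show ?case
    using pair_loopfree_digraph.pair_no_loops [OF assms(1)]
    by (fastforce simp: allowed_seqs_1 regular_proj_def)
qed (simp_all add: regular_proj_def frag_extend_diff)

text \<open>If the ordinary boundary of \<open>c\<close> is allowed, it contains no degenerate pair
  and the projection fixes it. The inclusion can be strict: with arcs in both directions between
  \<open>a\<close> and \<open>b\<close>, the projection removes the face \<open>[a, a]\<close> of
  \<open>[a, b, a]\<close>, which makes this sequence invariant in the regular complex only.\<close>

lemma path_boundaries_subset_regular:
  assumes "pair_loopfree_digraph G"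
  shows "path_boundaries path_boundary G 1 \<subseteq> path_boundaries regular_path_boundary G 1"
proof
  fix b assume "b \<in> path_boundaries path_boundary G 1"
  then obtain c where c: "c \<in> invariant_chains path_boundary G 2" "b = path_boundary c"
    by (auto simp: path_boundaries_def)
  then have "regular_path_boundary c = path_boundary c"
    using regular_proj_allowed [OF assms] by (simp add: regular_path_boundary_def invariant_chains_def)
  with c show "b \<in> path_boundaries regular_path_boundary G 1"
    by (auto simp: path_boundaries_def invariant_chains_def intro!: image_eqI [of _ _ c])
qed

section \<open>Boundaries up to torsion\<close>

definition torsion_boundary :: "'a pair_pre_digraph \<Rightarrow> ('a list \<Rightarrow>\<^sub>0 int) \<Rightarrow> bool" where
  "torsion_boundary G c \<longleftrightarrow> (\<exists>n. n \<noteq> 0 \<and> frag_cmul n c \<in> path_boundaries path_boundary G 1)"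

text \<open>The rank sees a cycle only up to nonzero multiples. One direction exploits the Betti
  number hypotheses on small graphs, the other yields the conclusion for the whole graph.\<close>

lemma path_betti_1_eq_0_iff:
  "path_betti 1 G = 0 \<longleftrightarrow> (\<forall>z. Poly_Mapping.keys z \<subseteq> allowed_seqs G 1 \<longrightarrow>
    path_boundary z = 0 \<longrightarrow> torsion_boundary G z)"
  unfolding path_betti_def
  by (subst path_homology_rank_eq_0_iff)
    (auto simp: path_boundary_diff path_cycles_1 torsion_boundary_def invariant_chains_def
      intro!: path_boundary_path_boundary)

lemma regular_path_betti_1_eq_0:
  assumes "pair_loopfree_digraph G" "path_betti 1 G = 0"
  shows "regular_path_betti 1 G = 0"
  unfolding regular_path_betti_def
proof (subst path_homology_rank_eq_0_iff)
  fix c assume "c \<in> invariant_chains regular_path_boundary G (1 + 1)"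
  then show "regular_path_boundary (regular_path_boundary c) = 0"
    by (intro regular_path_boundary_regular_path_boundary [of _ G]) (simp add: invariant_chains_def)
next
  show "\<forall>z\<in>path_cycles regular_path_boundary G 1.
      \<exists>n. n \<noteq> 0 \<and> frag_cmul n z \<in> path_boundaries regular_path_boundary G 1"
    using assms(2) path_boundaries_subset_regular [OF assms(1)]
    unfolding path_betti_1_eq_0_iff path_cycles_1 torsion_boundary_def by blast
qed (rule regular_path_boundary_diff)

lemma torsion_boundary_mono:
  assumes "torsion_boundary H c" "pverts H \<subseteq> pverts G" "parcs H \<subseteq> parcs G"
  shows "torsion_boundary G c"
  using assms path_boundaries_mono [OF assms(2,3)] unfolding torsion_boundary_def by blast

lemma path_boundaries_diff:
  assumes "a \<in> path_boundaries path_boundary G k" "b \<in> path_boundaries path_boundary G k"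
  shows "a - b \<in> path_boundaries path_boundary G k"
proof -
  from assms obtain c d where cd: "c \<in> invariant_chains path_boundary G (k + 1)" "a = path_boundary c"
    "d \<in> invariant_chains path_boundary G (k + 1)" "b = path_boundary d"
    unfolding path_boundaries_def by blast
  then have "c - d \<in> invariant_chains path_boundary G (k + 1)"
    using order_trans [OF keys_diff [of c d]]
      order_trans [OF keys_diff [of "path_boundary c" "path_boundary d"]]
    by (auto simp: invariant_chains_def path_boundary_diff)
  with cd show ?thesis
    unfolding path_boundaries_def by (intro image_eqI [of _ _ "c - d"]) (simp_all add: path_boundary_diff)
qed

lemma path_boundaries_0: "0 \<in> path_boundaries path_boundary G k"
  unfolding path_boundaries_def
  by (rule image_eqI [of _ _ 0]) (simp_all add: invariant_chains_def path_boundary_0)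

lemma torsion_boundary_0: "torsion_boundary G 0"
  unfolding torsion_boundary_def by (rule exI [of _ 1]) (simp add: path_boundaries_0)

lemma torsion_boundary_diff:
  assumes "torsion_boundary G a" "torsion_boundary G b"
  shows "torsion_boundary G (a - b)"
proof -
  from assms obtain m n where mn: "m \<noteq> 0" "frag_cmul m a \<in> path_boundaries path_boundary G 1"
    "n \<noteq> 0" "frag_cmul n b \<in> path_boundaries path_boundary G 1"
    unfolding torsion_boundary_def by blast
  have closed: "frag_cmul k c \<in> path_boundaries path_boundary G 1"
    if "c \<in> path_boundaries path_boundary G 1" for k c
    by (rule frag_closure_minus_cmul [where P = "\<lambda>c. c \<in> path_boundaries path_boundary G 1"])
      (use that in \<open>auto intro: path_boundaries_0 path_boundaries_diff\<close>)
  \<comment> \<open>The product \<open>m * n\<close> is a multiplier that works for both chains, and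
    it is nonzero because both factors are.\<close>
  have "frag_cmul (m * n) (a - b) = frag_cmul n (frag_cmul m a) - frag_cmul m (frag_cmul n b)"
    by (rule poly_mapping_eqI) (simp add: lookup_minus algebra_simps)
  moreover have "\<dots> \<in> path_boundaries path_boundary G 1"
    using closed [OF mn(2)] closed [OF mn(4)] by (rule path_boundaries_diff)
  ultimately show ?thesis
    unfolding torsion_boundary_def using mn by (intro exI [of _ "m * n"]) simp
qed

lemma torsion_boundary_uminus: "torsion_boundary G (- a) \<longleftrightarrow> torsion_boundary G a"
  using torsion_boundary_diff [OF torsion_boundary_0, of G a]
    torsion_boundary_diff [OF torsion_boundary_0, of G "- a"] by auto

lemma torsion_boundary_add:
  assumes "torsion_boundary G a" "torsion_boundary G b"
  shows "torsion_boundary G (a + b)"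
  using torsion_boundary_diff [OF assms(1), of "- b"] assms(2) by (simp add: torsion_boundary_uminus)

text \<open>All three faces of \<open>[u, v, w]\<close> are arcs, so this sequence is itself an
  invariant 2-chain. Transitive triangles are the only fillings given explicitly; the others come
  from vanishing Betti numbers of small graphs.\<close>

lemma torsion_boundary_triangle:
  assumes "(u, v) \<in> parcs G" "(v, w) \<in> parcs G" "(u, w) \<in> parcs G"
    and "u \<in> pverts G" "v \<in> pverts G" "w \<in> pverts G"
  shows "torsion_boundary G (frag_of [u, v] + frag_of [v, w] - frag_of [u, w])"
proof -
  let ?c = "frag_of [v, w] - frag_of [u, w] + frag_of [u, v]"
  have "Poly_Mapping.keys ?c \<subseteq> {[v, w], [u, w], [u, v]}"
    using keys_diff [of "frag_of [v, w]" "frag_of [u, w]"]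
      Poly_Mapping.keys_add [of "frag_of [v, w] - frag_of [u, w]" "frag_of [u, v]"] by auto
  moreover have "{[v, w], [u, w], [u, v]} \<subseteq> allowed_seqs G 1"
    using assms by (simp add: allowed_seqs_1)
  ultimately have "?c \<in> path_boundaries path_boundary G 1"
    unfolding path_boundaries_def using assms
    by (intro image_eqI [of _ _ "frag_of [u, v, w]"])
      (auto simp: invariant_chains_def path_boundary_of3 allowed_seqs_2)
  then show ?thesis
    unfolding torsion_boundary_def by (intro exI [of _ 1]) (simp add: algebra_simps)
qed

section \<open>Chains of undirected walks\<close>

text \<open>A relation instead of a function: where both \<open>(u, v)\<close> and
  \<open>(v, u)\<close> are arcs, a step from \<open>u\<close> to \<open>v\<close> can use either,
  with different chains. Accordingly one vertex list can have several walk chains.\<close>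

definition arc_chain :: "'a pair_pre_digraph \<Rightarrow> 'a \<Rightarrow> 'a \<Rightarrow> ('a list \<Rightarrow>\<^sub>0 int) \<Rightarrow> bool" where
  "arc_chain G u v x \<longleftrightarrow>
     (u, v) \<in> parcs G \<and> x = frag_of [u, v] \<or> (v, u) \<in> parcs G \<and> x = - frag_of [v, u]"

fun walk_chain :: "'a pair_pre_digraph \<Rightarrow> 'a list \<Rightarrow> ('a list \<Rightarrow>\<^sub>0 int) \<Rightarrow> bool" where
  "walk_chain G [] c \<longleftrightarrow> False"
| "walk_chain G [u] c \<longleftrightarrow> u \<in> pverts G \<and> c = 0"
| "walk_chain G (u # v # vs) c \<longleftrightarrow>
     u \<in> pverts G \<and> (\<exists>x d. arc_chain G u v x \<and> walk_chain G (v # vs) d \<and> c = x + d)"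

abbreviation adjacent :: "'a pair_pre_digraph \<Rightarrow> 'a \<Rightarrow> 'a \<Rightarrow> bool" where
  "adjacent G u v \<equiv> (u, v) \<in> parcs G \<or> (v, u) \<in> parcs G"

lemma arc_chain_uminus: "arc_chain G u v x \<Longrightarrow> arc_chain G v u (- x)"
  by (auto simp: arc_chain_def)

text \<open>The vertex \<open>y\<close> ends the first piece and starts the second, so each step
  belongs to exactly one piece and the chains add. All cutting and splicing of walks rests on
  this.\<close>

lemma walk_chain_append:
  "walk_chain G (xs @ y # ys) e \<longleftrightarrow>
    (\<exists>c d. walk_chain G (xs @ [y]) c \<and> walk_chain G (y # ys) d \<and> e = c + d)"
proof (induction xs arbitrary: e)
  case Nil
  have "y \<in> pverts G" if "walk_chain G (y # ys) e"
    using that by (cases ys) auto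
  then show ?case
    by auto
next
  case (Cons x xs)
  show ?case
  proof (cases xs)
    case Nil
    have "y \<in> pverts G" if "walk_chain G (y # ys) d" for d
      using that by (cases ys) auto
    then show ?thesis
      using Nil by auto
  next
    case (Cons x' xs')
    have "walk_chain G ((x # xs) @ y # ys) e \<longleftrightarrow> x \<in> pverts G \<and>
        (\<exists>z f. arc_chain G x x' z \<and> walk_chain G (xs @ y # ys) f \<and> e = z + f)"
      by (simp add: Cons)
    also have "\<dots> \<longleftrightarrow> x \<in> pverts G \<and> (\<exists>z c d. arc_chain G x x' z \<and>
        walk_chain G (xs @ [y]) c \<and> walk_chain G (y # ys) d \<and> e = z + (c + d))"
      unfolding Cons.IH by blast
    also have "\<dots> \<longleftrightarrow> (\<exists>c d. walk_chain G ((x # xs) @ [y]) c \<and> walk_chain G (y # ys) d \<and> e = c + d)"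
    proof
      assume "x \<in> pverts G \<and> (\<exists>z c d. arc_chain G x x' z \<and>
        walk_chain G (xs @ [y]) c \<and> walk_chain G (y # ys) d \<and> e = z + (c + d))"
      then obtain z c d where "x \<in> pverts G" "arc_chain G x x' z"
        "walk_chain G (xs @ [y]) c" "walk_chain G (y # ys) d" "e = z + (c + d)"
        by blast
      then show "\<exists>c d. walk_chain G ((x # xs) @ [y]) c \<and> walk_chain G (y # ys) d \<and> e = c + d"
        by (intro exI [of _ "z + c"] exI [of _ d]) (auto simp: Cons add.assoc)
    next
      assume "\<exists>c d. walk_chain G ((x # xs) @ [y]) c \<and> walk_chain G (y # ys) d \<and> e = c + d"
      then obtain z c d where "x \<in> pverts G" "arc_chain G x x' z"
        "walk_chain G (xs @ [y]) c" "walk_chain G (y # ys) d" "e = (z + c) + d"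
        by (auto simp: Cons)
      then show "x \<in> pverts G \<and> (\<exists>z c d. arc_chain G x x' z \<and>
        walk_chain G (xs @ [y]) c \<and> walk_chain G (y # ys) d \<and> e = z + (c + d))"
        unfolding add.assoc by blast
    qed
    finally show ?thesis .
  qed
qed

lemma walk_chain_rev: "walk_chain G vs c \<Longrightarrow> walk_chain G (rev vs) (- c)"
proof (induction vs arbitrary: c rule: induct_list012)
  case (3 u v vs)
  then obtain x d where x: "u \<in> pverts G" "arc_chain G u v x" "walk_chain G (v # vs) d" "c = x + d"
    by auto
  with 3 have rev: "walk_chain G (rev vs @ [v]) (- d)"
    by simp
  have "v \<in> pverts G"
    using x(3) by (cases vs) auto
  with x have "walk_chain G [v, u] (- x)"
    using arc_chain_uminus [OF x(2)] by auto
  with rev x(4) show ?case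
    using walk_chain_append [of G "rev vs" v "[u]"] by fastforce
qed auto

lemma walk_chain_imp_walk:
  "walk_chain G vs c \<Longrightarrow> vs \<noteq> [] \<and> set vs \<subseteq> pverts G \<and> successively (adjacent G) vs"
  by (induction G vs c rule: walk_chain.induct) (auto simp: arc_chain_def)

lemma walk_chain_exists:
  assumes "vs \<noteq> []" "set vs \<subseteq> pverts G" "successively (adjacent G) vs"
  shows "\<exists>c. walk_chain G vs c"
  using assms
proof (induction vs rule: induct_list012)
  case (3 u v vs)
  then obtain d where "walk_chain G (v # vs) d"
    by auto
  moreover have "\<exists>x. arc_chain G u v x"
    using 3 by (auto simp: arc_chain_def)
  ultimately show ?case
    using 3 by auto
qed auto

lemma walk_chain_mono:
  "walk_chain H vs c \<Longrightarrow> pverts H \<subseteq> pverts G \<Longrightarrow> parcs H \<subseteq> parcs G \<Longrightarrow> walk_chain G vs c"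
proof (induction vs arbitrary: c rule: induct_list012)
  case (3 u v vs)
  then obtain x d where x: "u \<in> pverts H" "arc_chain H u v x" "walk_chain H (v # vs) d" "c = x + d"
    by auto
  with 3 have "walk_chain G (v # vs) d" "u \<in> pverts G" "arc_chain G u v x"
    by (auto simp: arc_chain_def)
  with x(4) show ?case
    by auto
qed auto

text \<open>The boundary telescopes along the walk, so a closed walk carries a cycle.\<close>

lemma walk_chain_boundary:
  assumes "walk_chain G vs c"
  shows "Poly_Mapping.keys c \<subseteq> allowed_seqs G 1 \<and>
    path_boundary c = frag_of [last vs] - frag_of [hd vs]"
  using assms
proof (induction vs arbitrary: c rule: induct_list012)
  case (3 u v vs)
  then obtain x d where x: "u \<in> pverts G" "arc_chain G u v x" "walk_chain G (v # vs) d" "c = x + d"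
    by auto
  have "v \<in> pverts G"
    using x(3) by (cases vs) auto
  with x have "Poly_Mapping.keys x \<subseteq> allowed_seqs G 1"
    by (auto simp: arc_chain_def allowed_seqs_1)
  moreover have "path_boundary x = frag_of [v] - frag_of [u]"
    using x(2) path_boundary_diff [of 0 "frag_of [v, u]"]
    by (auto simp: arc_chain_def path_boundary_of2 path_boundary_0)
  moreover have "path_boundary c = path_boundary x + path_boundary d"
    using path_boundary_diff [of c d] x(4) by (simp add: algebra_simps)
  moreover have "Poly_Mapping.keys d \<subseteq> allowed_seqs G 1"
    "path_boundary d = frag_of [last (v # vs)] - frag_of [v]"
    using "3.IH"(2) [OF x(3)] by simp_all
  ultimately show ?case
    using x(4) Poly_Mapping.keys_add [of x d] by (simp add: subset_iff) blast
qed (auto simp: path_boundary_0)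

text \<open>By telescoping the difference is a cycle. This allows one walk to be exchanged for
  another inside a small graph.\<close>

lemma parallel_walk_chains:
  assumes "path_betti 1 H = 0" "walk_chain H vs c" "walk_chain H ws d" "hd vs = hd ws" "last vs = last ws"
  shows "torsion_boundary H (c - d)"
proof -
  have "Poly_Mapping.keys (c - d) \<subseteq> allowed_seqs H 1"
    using assms walk_chain_boundary keys_diff [of c d] by blast
  moreover have "path_boundary (c - d) = 0"
    using assms walk_chain_boundary [of H vs c] walk_chain_boundary [of H ws d]
    by (simp add: path_boundary_diff)
  ultimately show ?thesis
    using assms(1) by (simp add: path_betti_1_eq_0_iff)
qed

lemma undirected_path_walk:
  assumes "undirected_path G vs \<sigma>"
  shows "successively (adjacent G) vs"
  unfolding successively_conv_nth
proof (intro allI impI)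
  fix i assume "Suc i < length vs"
  then have "i < length vs - 1"
    by simp
  with assms show "adjacent G (vs ! i) (vs ! Suc i)"
    unfolding undirected_path_def by metis
qed

text \<open>Isolates the arc that a step uses, so that the same step can be rebuilt in any graph
  containing this arc.\<close>

lemma arc_chain_arc:
  assumes "arc_chain G u v x"
  obtains e where "e \<in> parcs G" "e = (u, v) \<or> e = (v, u)" "\<And>H. e \<in> parcs H \<Longrightarrow> arc_chain H u v x"
  using assms by (auto simp: arc_chain_def)

text \<open>An undirected path fixes one arc per step, and so does a walk chain. Taking for \<sigma>
  exactly the arcs used by \<open>c\<close> makes \<open>c\<close> a chain of the path itself, even
  where the graph has arcs in both directions.\<close>

lemma walk_chain_undirected_path:
  assumes "length vs = 4" "distinct vs" "walk_chain G vs c"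
  obtains \<sigma> where "undirected_path G vs \<sigma>" "walk_chain \<sigma> vs c" "pverts \<sigma> = set vs" "parcs \<sigma> \<subseteq> parcs G"
proof -
  obtain p q r s where vs: "vs = [p, q, r, s]"
    using assms(1) by (auto simp: length_Suc_conv numeral_eq_Suc)
  with assms(3) obtain x y z where xyz: "arc_chain G p q x" "arc_chain G q r y" "arc_chain G r s z"
    "c = x + (y + z)"
    by auto
  obtain e where e: "e \<in> parcs G" "e = (p, q) \<or> e = (q, p)" "\<And>H. e \<in> parcs H \<Longrightarrow> arc_chain H p q x"
    by (rule arc_chain_arc [OF xyz(1)]) blast
  obtain f where f: "f \<in> parcs G" "f = (q, r) \<or> f = (r, q)" "\<And>H. f \<in> parcs H \<Longrightarrow> arc_chain H q r y"
    by (rule arc_chain_arc [OF xyz(2)]) blast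
  obtain g where g: "g \<in> parcs G" "g = (r, s) \<or> g = (s, r)" "\<And>H. g \<in> parcs H \<Longrightarrow> arc_chain H r s z"
    by (rule arc_chain_arc [OF xyz(3)]) blast
  define \<sigma> where "\<sigma> = \<lparr>pverts = {p, q, r, s}, parcs = {e, f, g}\<rparr>"
  have "undirected_path G vs \<sigma>"
    unfolding undirected_path_def
  proof (intro conjI exI)
    show "\<forall>i<length vs - 1. [e, f, g] ! i \<in> parcs G \<and>
        ([e, f, g] ! i = (vs ! i, vs ! Suc i) \<or> [e, f, g] ! i = (vs ! Suc i, vs ! i))"
      using e f g by (auto simp: vs less_Suc_eq)
    show "parcs \<sigma> = (!) [e, f, g] ` {..<length vs - 1}"
      by (auto simp: vs \<sigma>_def lessThan_Suc)
  qed (use walk_chain_imp_walk [OF assms(3)] assms(2) in \<open>auto simp: vs \<sigma>_def\<close>)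
  moreover have "walk_chain \<sigma> vs c"
    using e(3) [of \<sigma>] f(3) [of \<sigma>] g(3) [of \<sigma>] xyz(4) by (auto simp: vs \<sigma>_def)
  ultimately show thesis
    by (rule that) (use e f g in \<open>auto simp: vs \<sigma>_def\<close>)
qed

section \<open>Closed walks\<close>

context
  fixes G :: "'a pair_pre_digraph"
  assumes loopfree: "pair_loopfree_digraph G"
    and path_centre: "\<And>vs \<sigma>. length vs = 4 \<Longrightarrow> undirected_path G vs \<sigma> \<Longrightarrow> \<not> reducible G vs \<sigma> \<Longrightarrow>
           \<exists>\<kappa>. directed_centre G vs \<sigma> \<kappa>"
    and cycle_centre: "\<And>vs. length vs = 2 \<or> length vs = 3 \<Longrightarrow> directed_cycle G vs \<Longrightarrow>
           \<exists>\<kappa>. cycle_centre G vs \<kappa>"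
begin

interpretation pair_loopfree_digraph G
  by (rule loopfree)

lemma no_loop: "(u, u) \<notin> parcs G"
  using pair_no_loops by fastforce

lemma triangle:
  assumes "(u, v) \<in> parcs G" "(v, w) \<in> parcs G" "(u, w) \<in> parcs G"
  shows "torsion_boundary G (frag_of [u, v] + frag_of [v, w] - frag_of [u, w])"
  using assms by (intro torsion_boundary_triangle) (auto intro: in_arcsD1 in_arcsD2)

text \<open>The path \<sigma> together with suitable arcs of the graph has vanishing first Betti
  number and contains a shorter walk with the same ends. There the two walks differ by a torsion
  boundary, which remains one in the larger graph.\<close>

lemma walk_shortcut:
  assumes "length vs = 4" "distinct vs" "walk_chain G vs c"
  obtains ws d where "walk_chain G ws d" "hd ws = hd vs" "last ws = last vs" "length ws \<le> 3"
    "torsion_boundary G (c - d)"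
proof -
  obtain \<sigma> where \<sigma>: "undirected_path G vs \<sigma>" "walk_chain \<sigma> vs c" "pverts \<sigma> = set vs" "parcs \<sigma> \<subseteq> parcs G"
    using walk_chain_undirected_path [OF assms] .
  have vsG: "set vs \<subseteq> pverts G"
    using walk_chain_imp_walk [OF assms(3)] by blast
  obtain p q r s where vs: "vs = [p, q, r, s]"
    using assms(1) by (auto simp: length_Suc_conv numeral_eq_Suc)
  \<comment> \<open>In the reducible case \<open>F\<close> is the extra arc; otherwise it is the arc
    set \<open>J\<close> of a directed centre.\<close>
  have "\<exists>F ws. F \<subseteq> parcs G \<and> path_betti 1 (union_arcs \<sigma> F) = 0 \<and> ws \<noteq> [] \<and>
      set ws \<subseteq> pverts (union_arcs \<sigma> F) \<and> successively (adjacent (union_arcs \<sigma> F)) ws \<and>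
      hd ws = hd vs \<and> last ws = last vs \<and> length ws \<le> 3"
  proof (cases "reducible G vs \<sigma>")
    case True
    then obtain i j where ij: "i < 4" "j < 4" "\<bar>int i - int j\<bar> > 1" "(vs ! i, vs ! j) \<in> parcs G"
      "path_betti 1 (union_arcs \<sigma> {(vs ! i, vs ! j)}) = 0"
      using assms(1) by (auto simp: reducible_def)
    let ?H = "union_arcs \<sigma> {(vs ! i, vs ! j)}"
    have verts: "set vs \<subseteq> pverts ?H"
      using \<sigma>(3) by (auto simp: union_arcs_def)
    have adj: "adjacent ?H p q" "adjacent ?H q r" "adjacent ?H r s"
      using walk_chain_imp_walk [OF \<sigma>(2)] by (auto simp: vs union_arcs_def)
    have "adjacent ?H (vs ! i) (vs ! j)"
      by (simp add: union_arcs_def)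
    \<comment> \<open>These are the non-consecutive positions, in both orders. Each such chord
      bypasses at least one inner vertex, which leaves a walk with at most three vertices.\<close>
    moreover from ij(1-3) have "(i, j) \<in> {(0, 2), (0, 3), (1, 3), (2, 0), (3, 0), (3, 1)}"
      by (auto simp: less_Suc_eq numeral_eq_Suc)
    ultimately consider "adjacent ?H p r" | "adjacent ?H p s" | "adjacent ?H q s"
      unfolding vs by (elim insertE emptyE) (simp_all, blast+)
    then have "\<exists>ws. ws \<noteq> [] \<and> set ws \<subseteq> pverts ?H \<and> successively (adjacent ?H) ws \<and>
        hd ws = hd vs \<and> last ws = last vs \<and> length ws \<le> 3"
    proof cases
      case 1
      with adj verts show ?thesis
        by (intro exI [of _ "[p, r, s]"]) (simp add: vs)
    next
      case 2
      with adj verts show ?thesis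
        by (intro exI [of _ "[p, s]"]) (simp add: vs)
    next
      case 3
      with adj verts show ?thesis
        by (intro exI [of _ "[p, q, s]"]) (simp add: vs)
    qed
    with ij show ?thesis
      by (intro exI [of _ "{(vs ! i, vs ! j)}"]) simp
  next
    case False
    then obtain \<kappa> where "directed_centre G vs \<sigma> \<kappa>"
      using path_centre [OF assms(1) \<sigma>(1)] by blast
    then obtain J \<rho> where J: "J \<subseteq> joining_arcs G \<sigma> \<kappa>" "path_betti 1 (union_arcs \<sigma> J) = 0"
      "undirected_path (union_arcs \<sigma> J) [hd vs, \<kappa>, last vs] \<rho>"
      unfolding directed_centre_def by blast
    moreover from J(3) have "set [hd vs, \<kappa>, last vs] \<subseteq> pverts (union_arcs \<sigma> J)"
      by (simp only: undirected_path_def)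
    moreover from J(1) have "J \<subseteq> parcs G"
      by (auto simp: joining_arcs_def)
    ultimately show ?thesis
      using undirected_path_walk [OF J(3)]
      by (intro exI [of _ J] exI [of _ "[hd vs, \<kappa>, last vs]"]) simp
  qed
  then obtain F ws where F: "F \<subseteq> parcs G" "path_betti 1 (union_arcs \<sigma> F) = 0"
    and ws: "ws \<noteq> []" "set ws \<subseteq> pverts (union_arcs \<sigma> F)" "successively (adjacent (union_arcs \<sigma> F)) ws"
      "hd ws = hd vs" "last ws = last vs" "length ws \<le> 3"
    by blast
  let ?H = "union_arcs \<sigma> F"
  have H: "pverts ?H \<subseteq> pverts G" "parcs ?H \<subseteq> parcs G"
    using F(1) \<sigma>(3,4) vsG
    by (auto simp: union_arcs_def intro: in_arcsD1 [OF subsetD [OF F(1)]] in_arcsD2 [OF subsetD [OF F(1)]])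
  obtain d where d: "walk_chain ?H ws d"
    using walk_chain_exists ws by blast
  have "walk_chain ?H vs c"
    by (rule walk_chain_mono [OF \<sigma>(2)]) (auto simp: union_arcs_def)
  then have "torsion_boundary ?H (c - d)"
    using ws(4,5) by (intro parallel_walk_chains [OF F(2) _ d]) simp_all
  with H ws d show thesis
    by (intro that) (auto intro: torsion_boundary_mono walk_chain_mono)
qed

section \<open>Closed walks with two or three steps\<close>

lemma cycle_2:
  assumes "(a, b) \<in> parcs G" "(b, a) \<in> parcs G"
  shows "torsion_boundary G (frag_of [a, b] + frag_of [b, a])"
proof -
  have "directed_cycle G [a, b]"
    using assms no_loop by (auto simp: directed_cycle_def less_Suc_eq intro: in_arcsD1 in_arcsD2)
  then obtain \<kappa> where "cycle_centre G [a, b] \<kappa>"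
    using cycle_centre [of "[a, b]"] by auto
  \<comment> \<open>Cone with apex \<kappa>: each arc of the cycle spans a transitive triangle with
    the apex, and the spokes cancel in the sum. The sequence \<open>[a, b, a]\<close> cannot fill
    the cycle, since its face \<open>[a, a]\<close> is not allowed.\<close>
  then consider "(\<kappa>, a) \<in> parcs G" "(\<kappa>, b) \<in> parcs G" | "(a, \<kappa>) \<in> parcs G" "(b, \<kappa>) \<in> parcs G"
    by (auto simp: cycle_centre_def)
  then show ?thesis
  proof cases
    case 1
    with assms show ?thesis
      using torsion_boundary_add [OF triangle [of \<kappa> a b] triangle [of \<kappa> b a]] by (simp add: algebra_simps)
  next
    case 2
    with assms show ?thesis
      using torsion_boundary_add [OF triangle [of a b \<kappa>] triangle [of b a \<kappa>]] by (simp add: algebra_simps)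
  qed
qed

lemma cycle_3:
  assumes "(a, b) \<in> parcs G" "(b, c) \<in> parcs G" "(c, a) \<in> parcs G"
  shows "torsion_boundary G (frag_of [a, b] + frag_of [b, c] + frag_of [c, a])"
proof -
  have "directed_cycle G [a, b, c]"
    using assms no_loop by (auto simp: directed_cycle_def less_Suc_eq intro: in_arcsD1 in_arcsD2)
  then obtain \<kappa> where "cycle_centre G [a, b, c] \<kappa>"
    using cycle_centre [of "[a, b, c]"] by auto
  then consider "(\<kappa>, a) \<in> parcs G" "(\<kappa>, b) \<in> parcs G" "(\<kappa>, c) \<in> parcs G"
    | "(a, \<kappa>) \<in> parcs G" "(b, \<kappa>) \<in> parcs G" "(c, \<kappa>) \<in> parcs G"
    by (auto simp: cycle_centre_def)
  then show ?thesis
  proof cases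
    case 1
    with assms show ?thesis
      using torsion_boundary_add [OF torsion_boundary_add [OF triangle [of \<kappa> a b] triangle [of \<kappa> b c]]
          triangle [of \<kappa> c a]] by (simp add: algebra_simps)
  next
    case 2
    with assms show ?thesis
      using torsion_boundary_add [OF torsion_boundary_add [OF triangle [of a b \<kappa>] triangle [of b c \<kappa>]]
          triangle [of c a \<kappa>]] by (simp add: algebra_simps)
  qed
qed

lemma closed_walk_2:
  assumes "walk_chain G [a, b, a] c"
  shows "torsion_boundary G c"
proof -
  from assms obtain x y where "arc_chain G a b x" "arc_chain G b a y" "c = x + y"
    by auto
  \<comment> \<open>If both steps use the same arc, the chain is zero; otherwise it is a directed
    2-cycle up to sign.\<close>
  then show ?thesis
    using cycle_2 [of a b] torsion_boundary_uminus [of G "frag_of [a, b] + frag_of [b, a]"]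
    by (auto simp: arc_chain_def torsion_boundary_0 algebra_simps)
qed

lemma closed_walk_3:
  assumes "walk_chain G [u, v, w, u] e"
  shows "torsion_boundary G e"
proof -
  have "torsion_boundary G (x + (y + z))"
    if "arc_chain G u v x" "arc_chain G v w y" "arc_chain G w u z" for x y z
    using that unfolding arc_chain_def
    \<comment> \<open>Of the eight orientations, all-forward and all-backward are directed cycles;
      the other six have a source and a sink and are transitive triangles up to sign.\<close>
    apply (elim disjE conjE)
    subgoal using cycle_3 [of u v w] by (simp add: algebra_simps)
    subgoal using triangle [of u v w] by (simp add: algebra_simps)
    subgoal using triangle [of w u v] by (simp add: algebra_simps)
    subgoal using torsion_boundary_uminus [THEN iffD2, OF triangle [of u w v]] by (simp add: algebra_simps)
    subgoal using triangle [of v w u] by (simp add: algebra_simps)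
    subgoal using torsion_boundary_uminus [THEN iffD2, OF triangle [of v u w]] by (simp add: algebra_simps)
    subgoal using torsion_boundary_uminus [THEN iffD2, OF triangle [of w v u]] by (simp add: algebra_simps)
    subgoal using torsion_boundary_uminus [THEN iffD2, OF cycle_3 [of u w v]] by (simp add: algebra_simps)
    done
  with assms show ?thesis
    by auto
qed

section \<open>Closed walks of any length\<close>

lemma closed_walk:
  "walk_chain G vs c \<Longrightarrow> hd vs = last vs \<Longrightarrow> torsion_boundary G c"
proof (induction "length vs" arbitrary: vs c rule: less_induct)
  case less
  note walk = less.prems(1) and closed = less.prems(2)
  have ne: "vs \<noteq> []"
    using walk by auto
  show ?case
  \<comment> \<open>The last vertex repeats the first by assumption, so repetitions are sought in
    \<open>butlast vs\<close> only.\<close>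
  proof (cases "distinct (butlast vs)")
    case False
    then obtain xs y ys zs where split: "butlast vs = xs @ [y] @ ys @ [y] @ zs"
      using not_distinct_decomp by blast
    \<comment> \<open>Cutting at both occurrences of \<open>y\<close> gives a loop at
      \<open>y\<close> and the closed walk that omits it. Since \<open>zs'\<close> contains the last
      vertex of \<open>vs\<close>, it is nonempty, and the loop is strictly shorter than
      \<open>vs\<close>.\<close>
    define zs' where "zs' = zs @ [last vs]"
    have vs: "vs = xs @ y # (ys @ y # zs')"
      using append_butlast_last_id [OF ne] by (simp add: split zs'_def)
    have zs': "zs' \<noteq> []"
      by (simp add: zs'_def)
    from walk obtain a f where af: "walk_chain G (xs @ [y]) a" "walk_chain G (y # ys @ y # zs') f" "c = a + f"
      unfolding vs by (blast dest: walk_chain_append [THEN iffD1])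
    have "walk_chain G ((y # ys) @ y # zs') f"
      using af(2) by simp
    then obtain b d where bd: "walk_chain G ((y # ys) @ [y]) b" "walk_chain G (y # zs') d" "f = b + d"
      by (blast dest: walk_chain_append [THEN iffD1])
    have "walk_chain G (xs @ y # zs') (a + d)"
      using af(1) bd(2) by (intro walk_chain_append [THEN iffD2]) blast
    moreover have "hd (xs @ y # zs') = last (xs @ y # zs')"
      using closed unfolding vs by (cases xs) (auto simp: zs'_def)
    ultimately have "torsion_boundary G (a + d)"
      by (rule less.hyps [rotated]) (simp add: vs)
    moreover have "torsion_boundary G b"
      by (rule less.hyps [OF _ bd(1)]) (use zs' in \<open>simp_all add: vs\<close>)
    ultimately have "torsion_boundary G ((a + d) + b)"
      by (rule torsion_boundary_add)
    then show ?thesis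
      by (simp add: af(3) bd(3) algebra_simps)
  next
    case True
    show ?thesis
    \<comment> \<open>Since \<open>length\<close> counts vertices, this means at least four steps.
      The fourth vertex is then not the closing one, so the first four vertices are
      distinct.\<close>
    proof (cases "length vs \<ge> 5")
      case True
      then obtain p q r s t us where vs: "vs = p # q # r # s # t # us"
        by (auto simp: numeral_eq_Suc Suc_le_length_iff)
      from walk have "walk_chain G ([p, q, r] @ s # t # us) c"
        by (simp only: vs append_Cons append_Nil)
      from walk_chain_append [THEN iffD1, OF this]
      obtain a b where ab: "walk_chain G [p, q, r, s] a" "walk_chain G (s # t # us) b" "c = a + b"
        unfolding append_Cons append_Nil by blast
      have "distinct [p, q, r, s]"
        using \<open>distinct (butlast vs)\<close> by (auto simp: vs split: if_splits)
      then obtain ws d where ws: "walk_chain G ws d" "hd ws = p" "last ws = s" "length ws \<le> 3"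
        "torsion_boundary G (a - d)"
        using walk_shortcut [OF _ _ ab(1)] by auto
      then have ws_split: "ws = butlast ws @ [s]"
        by (metis append_butlast_last_id walk_chain.simps(1))
      with ws(1) ab(2) have "walk_chain G (butlast ws @ s # t # us) (d + b)"
        by (intro walk_chain_append [THEN iffD2]) auto
      moreover have "hd (butlast ws @ s # t # us) = last (butlast ws @ s # t # us)"
      proof -
        have "hd (butlast ws @ s # t # us) = p"
          using ws(2) ws_split by (metis hd_append2 list.sel(1) append_Nil)
        with closed show ?thesis
          by (simp add: vs)
      qed
      \<comment> \<open>Three steps from \<open>p\<close> to \<open>s\<close> have become at most
        two, so the induction hypothesis applies.\<close>
      ultimately have "torsion_boundary G (d + b)"
        by (rule less.hyps [rotated]) (use ws(4) in \<open>simp add: vs\<close>)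
      from torsion_boundary_add [OF ws(5) this] show ?thesis
        by (simp add: ab(3))
    next
      case False
      moreover have "length vs > 0"
        using ne by simp
      ultimately have "length vs = 1 \<or> length vs = 2 \<or> length vs = 3 \<or> length vs = 4"
        by arith
      then consider "length vs = 1" | "length vs = 2" | "length vs = 3" | "length vs = 4"
        by blast
      then show ?thesis
      proof cases
        case 1
        then show ?thesis
          using walk by (auto simp: length_Suc_conv torsion_boundary_0)
      next
        \<comment> \<open>A closed walk with a single step would be a loop.\<close>
        case 2
        then obtain a b where "vs = [a, b]"
          by (auto simp: length_Suc_conv numeral_eq_Suc)
        with walk closed show ?thesis
          using no_loop by (auto simp: arc_chain_def)
      next
        case 3
        then obtain a b d where "vs = [a, b, d]"
          by (auto simp: length_Suc_conv numeral_eq_Suc)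
        with walk closed show ?thesis
          using closed_walk_2 by simp
      next
        case 4
        then obtain a b d e where "vs = [a, b, d, e]"
          by (auto simp: length_Suc_conv numeral_eq_Suc)
        with walk closed show ?thesis
          using closed_walk_3 by simp
      qed
    qed
  qed
qed

section \<open>From closed walks to arbitrary 1-cycles\<close>

lemma parallel_walks:
  assumes "walk_chain G vs c" "walk_chain G ws d" "hd vs = hd ws" "last vs = last ws"
  shows "torsion_boundary G (c - d)"
proof -
  have ne: "vs \<noteq> []" "ws \<noteq> []"
    using assms by auto
  have vs: "vs = butlast vs @ [last vs]"
    using ne by simp
  have ws: "rev ws = last vs # rev (butlast ws)"
    using ne assms(4) by (metis append_butlast_last_id rev_eq_Cons_iff rev_rev_ident)
  \<comment> \<open>Following \<open>vs\<close> and returning along \<open>ws\<close> is a closed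
    walk with chain \<open>c - d\<close>; the common last vertex must occur only once at the
    junction.\<close>
  have "walk_chain G (butlast vs @ [last vs]) c" "walk_chain G (last vs # rev (butlast ws)) (- d)"
    using assms(1) walk_chain_rev [OF assms(2)] unfolding ws vs [symmetric] by simp_all
  then have "walk_chain G (butlast vs @ last vs # rev (butlast ws)) (c - d)"
    by (subst walk_chain_append) fastforce
  then have "walk_chain G (butlast vs @ rev ws) (c - d)"
    by (simp add: ws)
  moreover have "hd (butlast vs @ rev ws) = hd vs"
    by (metis ws vs hd_append list.sel(1) append_Nil)
  moreover have "last (butlast vs @ rev ws) = hd ws"
    using ne by (simp add: last_rev)
  ultimately show ?thesis
    using assms(3) by (intro closed_walk [of "butlast vs @ rev ws"]) simp_all
qed

lemma walk_chain_snoc: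
  assumes "walk_chain G vs c" "arc_chain G (last vs) v x"
  shows "walk_chain G (vs @ [v]) (c + x)"
proof -
  have vs: "vs = butlast vs @ [last vs]"
    using assms(1) by (cases vs) auto
  have "walk_chain G [last vs, v] x"
    using assms(2) by (auto simp: arc_chain_def intro: in_arcsD1 in_arcsD2)
  moreover have "walk_chain G (butlast vs @ [last vs]) c"
    using vs assms(1) by simp
  ultimately have "walk_chain G (butlast vs @ last vs # [v]) (c + x)"
    by (subst walk_chain_append) blast
  with vs show ?thesis
    by (metis append_Cons append_Nil append_assoc)
qed

text \<open>
  Fix a root in every connected component and let \<open>p v\<close> be the chain of some walk from the
  root to \<open>v\<close>.  Then \<open>z = (\<Sum>e = (u, v). z\<^sub>e (p u + e - p v)) + P (\<partial> z)\<close>, where \<open>P\<close> is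
  the linear extension of \<open>p\<close>, and each \<open>p u + e - p v\<close> comes from a closed walk.
\<close>
lemma cycle_torsion_boundary:
  assumes z: "Poly_Mapping.keys z \<subseteq> allowed_seqs G 1" and cycle: "path_boundary z = 0"
  shows "torsion_boundary G z"
proof -
  define connected where "connected u v \<longleftrightarrow> (\<exists>vs c. walk_chain G vs c \<and> hd vs = u \<and> last vs = v)" for u v
  \<comment> \<open>The choice depends only on the set of vertices connected to \<open>v\<close>,
    which is constant on a component; so the two ends of an arc get the same root.\<close>
  define root where "root v = (SOME r. connected r v)" for v
  define is_path where "is_path v c \<longleftrightarrow> (\<exists>vs. walk_chain G vs c \<and> hd vs = root v \<and> last vs = v)" for v c
  define p where "p v = (SOME c. is_path v c)" for v
  \<comment> \<open>The basis elements of degree 0 are one-vertex lists, hence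
    \<open>hd\<close>.\<close>
  define P where "P = frag_extend (\<lambda>vs. p (hd vs))"
  have p: "is_path v (p v)" if "v \<in> pverts G" for v
  proof -
    have "connected v v"
      unfolding connected_def using that by (intro exI [of _ "[v]"]) auto
    then have "connected (root v) v"
      unfolding root_def by (rule someI)
    then have "\<exists>c. is_path v c"
      by (auto simp: connected_def is_path_def)
    then show ?thesis
      unfolding p_def by (rule someI_ex)
  qed
  have connected_step: "connected r v" if uv: "connected r u" "arc_chain G u v x" for r u v x
  proof -
    from uv(1) obtain vs c where vs: "walk_chain G vs c" "hd vs = r" "last vs = u"
      unfolding connected_def by blast
    then have "walk_chain G (vs @ [v]) (c + x)"
      using uv(2) by (intro walk_chain_snoc) simp_all
    moreover have "hd (vs @ [v]) = r"
      using vs by (cases vs) auto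
    ultimately show ?thesis
      unfolding connected_def by (metis last_snoc)
  qed
  have root: "root u = root v" if "arc_chain G u v x" for u v x
  proof -
    have "connected r u = connected r v" for r
      using connected_step [OF _ that] connected_step [OF _ arc_chain_uminus [OF that]] by blast
    then show ?thesis
      by (simp add: root_def)
  qed
  have arc: "torsion_boundary G (p u + frag_of [u, v] - p v)" if uv: "(u, v) \<in> parcs G" for u v
  proof -
    have x: "arc_chain G u v (frag_of [u, v])"
      using uv by (simp add: arc_chain_def)
    obtain vs where vs: "walk_chain G vs (p u)" "hd vs = root u" "last vs = u"
      using p [OF in_arcsD1 [OF uv]] unfolding is_path_def by blast
    obtain ws where ws: "walk_chain G ws (p v)" "hd ws = root v" "last ws = v"
      using p [OF in_arcsD2 [OF uv]] unfolding is_path_def by blast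
    have "hd (vs @ [v]) = root u"
      using vs by (cases vs) auto
    \<comment> \<open>The walk to \<open>u\<close> extended by the arc and the walk to
      \<open>v\<close> both lead from the common root to \<open>v\<close>.\<close>
    with root [OF x] ws vs x show ?thesis
      by (intro parallel_walks [OF walk_chain_snoc ws(1)]) simp_all
  qed
  have "torsion_boundary G (z - P (path_boundary z))"
    using z
  proof (induction z rule: frag_induction)
    case zero
    show ?case
      by (simp add: P_def path_boundary_0 torsion_boundary_0)
  next
    case (one e)
    then obtain u v where "e = [u, v]" "(u, v) \<in> parcs G"
      by (auto simp: allowed_seqs_1)
    with arc [of u v] show ?case
      by (simp add: P_def path_boundary_of2 frag_extend_diff algebra_simps)
  next
    case (diff a b)
    from torsion_boundary_diff [OF this] show ?case
      by (simp add: P_def path_boundary_diff frag_extend_diff algebra_simps)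
  qed
  then show ?thesis
    by (simp add: cycle P_def)
qed

end

theorem proposition4p12:
  fixes G :: "'a pair_pre_digraph"
  assumes "pair_loopfree_digraph G"
    and "\<And>vs \<sigma>. length vs = 4 \<Longrightarrow> undirected_path G vs \<sigma> \<Longrightarrow> \<not> reducible G vs \<sigma> \<Longrightarrow>
           \<exists>\<kappa>. directed_centre G vs \<sigma> \<kappa>"
    and "\<And>vs. length vs = 2 \<or> length vs = 3 \<Longrightarrow> directed_cycle G vs \<Longrightarrow> \<exists>\<kappa>. cycle_centre G vs \<kappa>"
  shows "path_betti 1 G = 0 \<and> regular_path_betti 1 G = 0"
proof -
  have "path_betti 1 G = 0"
    unfolding path_betti_1_eq_0_iff using cycle_torsion_boundary [OF assms] by blast
  with assms(1) show ?thesis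
    by (simp add: regular_path_betti_1_eq_0)
qed

end
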